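(* Let $\mathcal{A}=(a_n)_{n\in\mathbb{N}_+}$ be a sequence of positive integers. The inequality \[ \lim_{N\to\infty}\frac{\#\{n\leqslant N:\ p_\mathcal{A}(n,k)\equiv 1\pmod{2}\}}{N}\leqslant\frac{2}{3} \] holds for infinitely many positive integers $k$. More precisely, if this inequality fails for some positive integer $k$, then it holds for $k+1$.
   Context: $\mathbb{N}=\{0,1,2,\ldots\}$, and $n$ ranges over $\mathbb{N}$. For $k\in\mathbb{N}_+$ and $n\in\mathbb{N}$, $p_\mathcal{A}(n,k)$ is the number of tuples $(x_1,\ldots,x_k)\in\mathbb{N}^k$ with $a_1x_1+\cdots+a_kx_k=n$, i.e. $\sum_{n\ge0}p_\mathcal{A}(n,k)x^n=\prod_{i=1}^k(1-x^{a_i})^{-1}$. *)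

theory Defs
  imports Complex_Main "HOL-Library.FuncSet" "HOL-Number_Theory.Cong"
begin

text \<open>The sequence is indexed from 1; the value \<open>a 0\<close> is never used. Tuples
  \<open>(x 1, \<dots>, x k)\<close> are represented by extensional functions on \<open>{1..k}\<close>.\<close>

definition restricted_partitions :: "(nat \<Rightarrow> nat) \<Rightarrow> nat \<Rightarrow> nat \<Rightarrow> nat" where
  "restricted_partitions a n k =
     card {x \<in> {1..k} \<rightarrow>\<^sub>E (UNIV :: nat set). (\<Sum>i=1..k. a i * x i) = n}"

definition odd_proportion :: "(nat \<Rightarrow> nat) \<Rightarrow> nat \<Rightarrow> nat \<Rightarrow> real" where
  "odd_proportion a k N =
     real (card {n. n \<le> N \<and> [restricted_partitions a n k = 1] (mod 2)}) / real N"

end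

theory Submission
  imports Defs "HOL-Library.Infinite_Set"
begin

text \<open>Write \<open>p k n\<close> for the number of representations and \<open>b = a (k + 1)\<close>. Then
  \<open>p (k + 1) (n + b) = p (k + 1) n + p k (n + b)\<close>. If \<open>p k\<close> has period \<open>T\<close> modulo 2, then
  \<open>p (k + 1) (n + T b)\<close> and \<open>p (k + 1) n\<close> differ by a sum over a full cycle of the residues
  \<open>n + j b\<close>, and adding this sum twice gives 0 modulo 2; hence \<open>p (k + 1)\<close> has period \<open>2 T b\<close>
  and all densities exist. Moreover, whenever \<open>p k n\<close> is odd, one of \<open>p (k + 1) n\<close> and
  \<open>p (k + 1) (n - b)\<close> is even, so the odd densities satisfy \<open>d k \<le> 2 (1 - d (k + 1))\<close>.\<close>

section \<open>Solution sets and the recurrence in the number of variables\<close>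

definition representations :: "(nat \<Rightarrow> nat) \<Rightarrow> nat \<Rightarrow> nat \<Rightarrow> (nat \<Rightarrow> nat) set" where
  "representations a n k = {x \<in> {1..k} \<rightarrow>\<^sub>E UNIV. (\<Sum>i=1..k. a i * x i) = n}"

lemma restricted_partitions_eq_card:
  "restricted_partitions a n k = card (representations a n k)"
  by (simp add: restricted_partitions_def representations_def)

text \<open>Positivity confines every coordinate to \<open>{..n}\<close>. An infinite set would have
  \<open>card\<close> 0, so finiteness is what lets the recurrence split cardinalities.\<close>

lemma finite_representations:
  assumes pos: "\<And>i. i \<ge> 1 \<Longrightarrow> a i > 0"
  shows "finite (representations a n k)"
proof (rule finite_subset)
  show "representations a n k \<subseteq> {1..k} \<rightarrow>\<^sub>E {..n}"
  proof
    fix x assume x: "x \<in> representations a n k"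
    have "x i \<le> n" if i: "i \<in> {1..k}" for i
    proof -
      have "x i \<le> a i * x i" using pos[of i] i by simp
      also have "\<dots> \<le> (\<Sum>i=1..k. a i * x i)"
        by (rule member_le_sum[OF i]) auto
      also have "\<dots> = n" using x by (simp add: representations_def)
      finally show ?thesis .
    qed
    then show "x \<in> {1..k} \<rightarrow>\<^sub>E {..n}"
      using x by (auto simp: representations_def PiE_iff)
  qed
qed (simp add: finite_PiE)

lemma representations_last_zero:
  "{x \<in> representations a n (Suc k). x (Suc k) = 0}
     = (\<lambda>x. x(Suc k := 0)) ` representations a n k"
proof (intro equalityI subsetI)
  fix x assume x: "x \<in> {x \<in> representations a n (Suc k). x (Suc k) = 0}"
  \<comment> \<open>Extensional functions on \<open>{1..k}\<close> are \<open>undefined\<close> at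
    \<open>Suc k\<close>, so dropping the last coordinate means resetting it to that value.\<close>
  let ?y = "x(Suc k := undefined)"
  have s: "(\<Sum>i=1..k. a i * ?y i) = (\<Sum>i=1..k. a i * x i)"
    by (rule sum.cong) auto
  have "?y \<in> representations a n k"
    using x s by (auto simp: representations_def PiE_iff extensional_def)
  moreover have "x = ?y(Suc k := 0)" using x by auto
  ultimately show "x \<in> (\<lambda>x. x(Suc k := 0)) ` representations a n k" by blast
next
  fix x assume "x \<in> (\<lambda>x. x(Suc k := 0)) ` representations a n k"
  then obtain y where y: "y \<in> representations a n k" "x = y(Suc k := 0)" by blast
  have "(\<Sum>i=1..k. a i * x i) = (\<Sum>i=1..k. a i * y i)"
    using y by (intro sum.cong) auto
  then show "x \<in> {x \<in> representations a n (Suc k). x (Suc k) = 0}"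
    using y by (auto simp: representations_def PiE_iff extensional_def)
qed

text \<open>Lowering a positive last coordinate by one lowers the weighted sum by exactly
  \<open>a (Suc k)\<close>.\<close>

lemma representations_last_pos:
  "{x \<in> representations a (n + a (Suc k)) (Suc k). x (Suc k) > 0}
     = (\<lambda>x. x(Suc k := Suc (x (Suc k)))) ` representations a n (Suc k)"
proof (intro equalityI subsetI)
  fix x assume x: "x \<in> {x \<in> representations a (n + a (Suc k)) (Suc k). x (Suc k) > 0}"
  let ?y = "x(Suc k := x (Suc k) - 1)"
  have s: "(\<Sum>i=1..k. a i * ?y i) = (\<Sum>i=1..k. a i * x i)"
    by (rule sum.cong) auto
  obtain m where m: "x (Suc k) = Suc m" using x gr0_implies_Suc by auto
  have "?y \<in> representations a n (Suc k)"
    using x s m by (auto simp: representations_def PiE_iff extensional_def)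
  moreover have "x = ?y(Suc k := Suc (?y (Suc k)))" using x by auto
  ultimately show "x \<in> (\<lambda>x. x(Suc k := Suc (x (Suc k)))) ` representations a n (Suc k)"
    by blast
next
  fix x assume "x \<in> (\<lambda>x. x(Suc k := Suc (x (Suc k)))) ` representations a n (Suc k)"
  then obtain y where y: "y \<in> representations a n (Suc k)" "x = y(Suc k := Suc (y (Suc k)))"
    by blast
  have "(\<Sum>i=1..k. a i * x i) = (\<Sum>i=1..k. a i * y i)"
    using y by (intro sum.cong) auto
  then show "x \<in> {x \<in> representations a (n + a (Suc k)) (Suc k). x (Suc k) > 0}"
    using y by (auto simp: representations_def PiE_iff extensional_def)
qed

text \<open>Splitting on whether the last coordinate is 0 gives the coefficient form of
  \<open>(1 - x^b) * G (k + 1) = G k\<close> for the generating functions, with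
  \<open>b = a (Suc k)\<close>. Shifting the argument up by \<open>b\<close> avoids truncated
  subtraction.\<close>

lemma restricted_partitions_rec:
  assumes pos: "\<And>i. i \<ge> 1 \<Longrightarrow> a i > 0"
  shows "restricted_partitions a (n + a (Suc k)) (Suc k)
           = restricted_partitions a (n + a (Suc k)) k + restricted_partitions a n (Suc k)"
proof -
  let ?R = "representations a (n + a (Suc k)) (Suc k)"
  let ?Z = "{x \<in> ?R. x (Suc k) = 0}" and ?P = "{x \<in> ?R. x (Suc k) > 0}"
  have fin: "finite ?R" by (rule finite_representations[OF pos])
  have "card ?R = card (?Z \<union> ?P)" by (rule arg_cong[of _ _ card]) auto
  also have "\<dots> = card ?Z + card ?P" by (rule card_Un_disjoint) (use fin in auto)
  also have "card ?Z = card (representations a (n + a (Suc k)) k)"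
    unfolding representations_last_zero
  proof (intro card_image inj_onI ext)
    fix x y :: "nat \<Rightarrow> nat" and i
    assume "x \<in> representations a (n + a (Suc k)) k" "y \<in> representations a (n + a (Suc k)) k"
      and e: "x(Suc k := 0) = y(Suc k := 0)"
    \<comment> \<open>The update forgets the value at \<open>Suc k\<close>, but both functions are
      \<open>undefined\<close> there.\<close>
    then have "x (Suc k) = y (Suc k)"
      by (auto simp: representations_def PiE_iff extensional_def)
    then show "x i = y i" using fun_cong[OF e, of i] by (cases "i = Suc k") auto
  qed
  also have "card ?P = card (representations a n (Suc k))"
    unfolding representations_last_pos
  proof (intro card_image inj_onI ext)
    fix x y :: "nat \<Rightarrow> nat" and i
    assume "x(Suc k := Suc (x (Suc k))) = y(Suc k := Suc (y (Suc k)))"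
    from fun_cong[OF this, of i] show "x i = y i" by (cases "i = Suc k") auto
  qed
  finally show ?thesis by (simp add: restricted_partitions_eq_card)
qed

text \<open>The empty tuple represents 0, so the count at 0 is 1; this is why periodicity is assumed
  and asserted only from 1 on.\<close>

lemma restricted_partitions_0: "n \<ge> 1 \<Longrightarrow> restricted_partitions a n 0 = 0"
  by (simp add: restricted_partitions_def)

section \<open>Periodicity modulo 2\<close>

lemma parity_periodic_step:
  fixes f g :: "nat \<Rightarrow> nat"
  assumes rec: "\<And>n. g (n + b) = f (n + b) + g n" and b: "b > 0"
    and per: "\<And>n. n \<ge> 1 \<Longrightarrow> even (f (n + T)) = even (f n)"
  shows "even (g (n + 2 * T * b)) = even (g n)"
proof -
  \<comment> \<open>Since \<open>b > 0\<close>, all arguments of \<open>f\<close> here are positive,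
    so its periodicity from 1 on suffices even for \<open>n = 0\<close>.\<close>
  have iter: "g (n + m * b) = g n + (\<Sum>j<m. f (n + Suc j * b))" for m
  proof (induction m)
    case (Suc m)
    have "g (n + Suc m * b) = f (n + Suc m * b) + g (n + m * b)"
      using rec[of "n + m * b"] by (simp add: algebra_simps)
    with Suc show ?case by simp
  qed simp
  have shift: "even (f (m + c * T)) = even (f m)" if "m \<ge> 1" for m c
  proof (induction c)
    case (Suc c)
    then show ?case using per[of "m + c * T"] that by (simp add: algebra_simps)
  qed simp
  \<comment> \<open>Adding \<open>T\<close> to the index moves the argument by \<open>T * b\<close>,
    which is \<open>b\<close> whole periods of \<open>f\<close>.\<close>
  have cycle: "even (f (n + Suc (T + j) * b)) = even (f (n + Suc j * b))" for j
    using shift[of "n + Suc j * b" b] b by (simp add: algebra_simps)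
  have split: "(\<Sum>j<T + m. f (n + Suc j * b))
      = (\<Sum>j<T. f (n + Suc j * b)) + (\<Sum>j<m. f (n + Suc (T + j) * b))" for m
    by (induction m) (simp_all add: add.assoc)
  have "(\<Sum>j<2 * T. f (n + Suc j * b))
          = (\<Sum>j<T. f (n + Suc j * b)) + (\<Sum>j<T. f (n + Suc (T + j) * b))"
    using split[of T] by (simp only: mult_2)
  also have "\<dots> = (\<Sum>j<T. f (n + Suc j * b) + f (n + Suc (T + j) * b))"
    by (simp only: sum.distrib)
  also have "even \<dots>"
    by (rule dvd_sum) (simp only: even_add cycle)
  finally show ?thesis using iter[of "2 * T"] by simp
qed

lemma restricted_partitions_parity_periodic:
  assumes pos: "\<And>i. i \<ge> 1 \<Longrightarrow> a i > 0"
  shows "\<exists>T>0. \<forall>n\<ge>1. even (restricted_partitions a (n + T) k)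
                         = even (restricted_partitions a n k)"
proof (induction k)
  case 0
  show ?case by (rule exI[of _ 1]) (simp add: restricted_partitions_0)
next
  case (Suc k)
  then obtain T where T: "T > 0" "\<And>n. n \<ge> 1 \<Longrightarrow>
      even (restricted_partitions a (n + T) k) = even (restricted_partitions a n k)" by blast
  have b: "a (Suc k) > 0" using pos by simp
  have "even (restricted_partitions a (n + 2 * T * a (Suc k)) (Suc k))
          = even (restricted_partitions a n (Suc k))" for n
    by (rule parity_periodic_step[OF restricted_partitions_rec[OF pos] b T(2)])
  then show ?case using T(1) b by (intro exI[of _ "2 * T * a (Suc k)"]) simp
qed

section \<open>Existence of the densities\<close>

lemma convergent_density_periodic:
  fixes P :: "nat \<Rightarrow> bool"
  assumes T: "T > 0" and per: "\<And>n. n \<ge> 1 \<Longrightarrow> P (n + T) = P n"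
  shows "convergent (\<lambda>N. real (card {n. n \<le> N \<and> P n}) / real N)"
proof -
  define C where "C N = card {n. n \<le> N \<and> P n}" for N
  \<comment> \<open>Number of hits in one full period \<open>{1..T}\<close>; 0 is removed because it
    may break the pattern.\<close>
  define c where "c = real (C T) - real (C 0)"
  have C_Suc: "C (Suc N) = C N + of_bool (P (Suc N))" for N
  proof (cases "P (Suc N)")
    case True
    then have "{n. n \<le> Suc N \<and> P n} = insert (Suc N) {n. n \<le> N \<and> P n}"
      by (auto simp: le_Suc_eq)
    with True show ?thesis by (simp add: C_def)
  next
    case False
    then have "{n. n \<le> Suc N \<and> P n} = {n. n \<le> N \<and> P n}"
      by (auto simp: le_Suc_eq)
    with False show ?thesis by (simp add: C_def)
  qed
  \<comment> \<open>Sliding a window of length \<open>T\<close> by one trades the indicator at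
    \<open>N + 1\<close> for the equal one at \<open>N + T + 1\<close>.\<close>
  have window: "real (C (N + T)) = real (C N) + c" for N
  proof (induction N)
    case (Suc N)
    then show ?case using C_Suc[of N] C_Suc[of "N + T"] per[of "Suc N"] by simp
  qed (simp add: c_def)
  \<comment> \<open>Deviation of the count from its linear trend. It is \<open>T\<close>-periodic,
    so it takes finitely many values and vanishes after division by \<open>N\<close>.\<close>
  define D where "D N = real (C N) - c / T * N" for N
  have D_add: "D (N + m * T) = D N" for N m
  proof (induction m)
    case (Suc m)
    have "D (N + Suc m * T) = D (N + m * T)"
      using window[of "N + m * T"] T by (simp add: D_def field_simps)
    with Suc show ?case by simp
  qed simp
  have "D N \<in> D ` {..<T}" for N
    using D_add[of "N mod T" "N div T"] T
    by (metis mod_mult_div_eq mult.commute imageI lessThan_iff mod_less_divisor)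
  then have "range D \<subseteq> D ` {..<T}" by blast
  then have "finite (range D)" by (rule finite_subset) simp
  then have bound: "norm (D N) \<le> Max (norm ` range D)" for N
    by (intro Max_ge) auto
  have "(\<lambda>N. D N * (1 / real N)) \<longlonglongrightarrow> 0"
  proof (rule tendsto_0_le[OF lim_1_over_n])
    show "\<forall>\<^sub>F N in sequentially.
        norm (D N * (1 / real N)) \<le> norm (1 / real N) * Max (norm ` range D)"
      using bound by (intro always_eventually allI) (simp add: divide_right_mono)
  qed
  then have "(\<lambda>N. c / T + D N * (1 / real N)) \<longlonglongrightarrow> c / T + 0"
    by (intro tendsto_intros)
  \<comment> \<open>Division by 0 yields 0, so the identity may fail at \<open>N = 0\<close> and is
    claimed only eventually.\<close>
  moreover have "\<forall>\<^sub>F N in sequentially. c / T + D N * (1 / real N) = real (C N) / real N"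
    using eventually_gt_at_top[of 0] by eventually_elim (simp add: D_def field_simps)
  ultimately have "(\<lambda>N. real (C N) / real N) \<longlonglongrightarrow> c / T + 0"
    by (rule Lim_transform_eventually)
  then show ?thesis unfolding C_def by (rule convergentI)
qed

lemma odd_proportion_altdef:
  "odd_proportion a k N = real (card {n. n \<le> N \<and> odd (restricted_partitions a n k)}) / real N"
  by (simp add: odd_proportion_def cong_def odd_iff_mod_2_eq_one)

text \<open>The value of \<open>lim\<close> is informative only when the limit exists, which
  periodicity of the parities guarantees.\<close>

lemma convergent_odd_proportion:
  assumes pos: "\<And>i. i \<ge> 1 \<Longrightarrow> a i > 0"
  shows "convergent (odd_proportion a k)"
proof -
  obtain T where "T > 0" "\<forall>n\<ge>1. even (restricted_partitions a (n + T) k)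
                         = even (restricted_partitions a n k)"
    using restricted_partitions_parity_periodic[of a k, OF pos] by blast
  then show ?thesis
    unfolding odd_proportion_altdef[abs_def] by (intro convergent_density_periodic[of T]) auto
qed

section \<open>The inequality between consecutive densities\<close>

lemma odd_count_le:
  assumes pos: "\<And>i. i \<ge> 1 \<Longrightarrow> a i > 0"
  shows "card {n. n \<le> N \<and> odd (restricted_partitions a n k)}
           + 2 * card {n. n \<le> N \<and> odd (restricted_partitions a n (Suc k))}
         \<le> 2 * (N + 1) + a (Suc k)"
proof -
  let ?p = "restricted_partitions a" and ?b = "a (Suc k)"
  let ?O = "{n. n \<le> N \<and> odd (?p n (Suc k))}" and ?E = "{n. n \<le> N \<and> even (?p n (Suc k))}"
  \<comment> \<open>The recurrence needs a predecessor \<open>n - ?b\<close>; the at most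
    \<open>?b\<close> arguments without one are covered wholesale. Shifted elements beyond
    \<open>N\<close> do no harm in an upper bound.\<close>
  have "{n. n \<le> N \<and> odd (?p n k)} \<subseteq> ?E \<union> (\<lambda>n. n + ?b) ` ?E \<union> {..<?b}"
  proof
    fix n assume n: "n \<in> {n. n \<le> N \<and> odd (?p n k)}"
    show "n \<in> ?E \<union> (\<lambda>n. n + ?b) ` ?E \<union> {..<?b}"
    proof (cases "n < ?b")
      case False
      then obtain m where m: "n = m + ?b" by (metis le_add_diff_inverse2 not_less)
      then have "even (?p n (Suc k)) \<or> even (?p m (Suc k))"
        using n restricted_partitions_rec[of a m k, OF pos] by auto
      then show ?thesis using n m by auto
    qed simp
  qed
  then have "card {n. n \<le> N \<and> odd (?p n k)} \<le> card (?E \<union> (\<lambda>n. n + ?b) ` ?E \<union> {..<?b})"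
    by (intro card_mono) auto
  also have "\<dots> \<le> card ?E + card ((\<lambda>n. n + ?b) ` ?E) + card {..<?b}"
    by (meson add_le_mono1 card_Un_le le_trans)
  also have "\<dots> \<le> 2 * card ?E + ?b"
    using card_image_le[of ?E "\<lambda>n. n + ?b"] by simp
  finally have le: "card {n. n \<le> N \<and> odd (?p n k)} \<le> 2 * card ?E + ?b" .
  have "card ?O + card ?E = card (?O \<union> ?E)"
    by (rule card_Un_disjoint[symmetric]) auto
  also have "?O \<union> ?E = {..N}" by auto
  finally show ?thesis using le by simp
qed

lemma lim_odd_proportion_le:
  assumes pos: "\<And>i. i \<ge> 1 \<Longrightarrow> a i > 0"
  shows "lim (odd_proportion a k) + 2 * lim (odd_proportion a (Suc k)) \<le> 2"
proof (rule LIMSEQ_le)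
  show "(\<lambda>N. odd_proportion a k N + 2 * odd_proportion a (Suc k) N)
          \<longlonglongrightarrow> lim (odd_proportion a k) + 2 * lim (odd_proportion a (Suc k))"
    using convergent_odd_proportion[of a, OF pos]
    by (intro tendsto_intros) (simp_all add: convergent_LIMSEQ_iff)
  \<comment> \<open>The bound \<open>2 * (N + 1) + a (Suc k)\<close> divided by \<open>N\<close>,
    with its vanishing error split off.\<close>
  have "(\<lambda>N. 2 + (2 + real (a (Suc k))) * (1 / real N)) \<longlonglongrightarrow> 2 + (2 + real (a (Suc k))) * 0"
    by (intro tendsto_intros lim_1_over_n)
  then show "(\<lambda>N. 2 + (2 + real (a (Suc k))) * (1 / real N)) \<longlonglongrightarrow> 2" by simp
  have "odd_proportion a k N + 2 * odd_proportion a (Suc k) N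
          \<le> 2 + (2 + real (a (Suc k))) * (1 / real N)" if "N \<ge> 1" for N
  proof -
    have "real (card {n. n \<le> N \<and> odd (restricted_partitions a n k)})
           + 2 * real (card {n. n \<le> N \<and> odd (restricted_partitions a n (Suc k))})
         \<le> 2 * (real N + 1) + real (a (Suc k))"
      using of_nat_mono[OF odd_count_le[of a N k, OF pos], where 'a = real] by simp
    from divide_right_mono[OF this, of "real N"] show ?thesis
      using that by (simp add: odd_proportion_altdef add_divide_distrib)
  qed
  then show "\<exists>M. \<forall>N\<ge>M. odd_proportion a k N + 2 * odd_proportion a (Suc k) N
          \<le> 2 + (2 + real (a (Suc k))) * (1 / real N)" by blast
qed

theorem theorem4p2:
  fixes a :: "nat \<Rightarrow> nat"
  assumes "\<And>i. i \<ge> 1 \<Longrightarrow> a i > 0"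
  shows "(\<forall>k\<ge>1. convergent (odd_proportion a k)) \<and>
         infinite {k. k \<ge> 1 \<and> lim (odd_proportion a k) \<le> 2 / 3} \<and>
         (\<forall>k\<ge>1. \<not> lim (odd_proportion a k) \<le> 2 / 3 \<longrightarrow> lim (odd_proportion a (k + 1)) \<le> 2 / 3)"
proof -
  \<comment> \<open>With d for the limits, d(k) > 2/3 forces 2 d(k+1) \<le> 2 - d(k) < 4/3; the
    threshold 2/3 is the fixed point of d = 2 (1 - d).\<close>
  have step: "lim (odd_proportion a (k + 1)) \<le> 2 / 3"
    if "\<not> lim (odd_proportion a k) \<le> 2 / 3" for k
    using lim_odd_proportion_le[of a k, OF assms] that by simp
  \<comment> \<open>Of \<open>m + 1\<close> and \<open>m + 2\<close> at least one satisfies the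
    bound, so the set is unbounded.\<close>
  have "\<exists>n>m. n \<in> {k. k \<ge> 1 \<and> lim (odd_proportion a k) \<le> 2 / 3}" for m
    using step[of "m + 1"]
    by (cases "lim (odd_proportion a (m + 1)) \<le> 2 / 3")
       (auto intro: exI[of _ "m + 1"] exI[of _ "m + 2"])
  then have "infinite {k. k \<ge> 1 \<and> lim (odd_proportion a k) \<le> 2 / 3}"
    by (simp only: infinite_nat_iff_unbounded) blast
  then show ?thesis using step convergent_odd_proportion[of a, OF assms] by blast
qed

end
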